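(* Suppose $n=\Omega(\log m)$. Any single-pass streaming algorithm that, with probability $2/3$, decides whether $\mathrm{OPT}=1$ or $\mathrm{OPT}=2$ for $\textup{Max-AND-SAT}$ instances with $m$ clauses over $n$ variables must use $\Omega(mn)$ bits of space.
   Context: $\textup{Max-AND-SAT}$: given $m$ clauses over Boolean variables $x_1,\dots,x_n$, each clause a conjunction of literals (a literal is a variable or its negation), find an assignment maximizing the number of satisfied clauses. $\mathrm{OPT}$ is this maximum. The clauses arrive one at a time in a stream, and the algorithm makes a single pass. Space is measured in bits.
   Formalization: "n = Ω(log m)" is taken as n ≥ K log₂ m for any fixed K > 1, with m ≥ 2 and the constant in Ω(mn) depending on K; for n ≤ log₂ m the claim fails, since 2^n + 1 bits suffice, and for m = 1 no space is needed. *)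

theory Defs
  imports "HOL-Probability.Probability"
begin

datatype literal = Pos nat | Neg nat

primrec lit_var :: "literal \<Rightarrow> nat" where
  "lit_var (Pos i) = i"
| "lit_var (Neg i) = i"

primrec lit_holds :: "(nat \<Rightarrow> bool) \<Rightarrow> literal \<Rightarrow> bool" where
  "lit_holds a (Pos i) \<longleftrightarrow> a i"
| "lit_holds a (Neg i) \<longleftrightarrow> \<not> a i"

type_synonym clause = "literal set"

definition clause_holds :: "(nat \<Rightarrow> bool) \<Rightarrow> clause \<Rightarrow> bool" where
  "clause_holds a C \<longleftrightarrow> (\<forall>l\<in>C. lit_holds a l)"

text \<open>The clauses are listed in their order of arrival and may repeat. Any set of literals over
  the variables with indices 1, ..., n is a clause, also one containing a variable together with
  its negation.\<close>

definition instances :: "nat \<Rightarrow> nat \<Rightarrow> clause list set" where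
  "instances m n = {\<phi>. length \<phi> = m \<and> (\<forall>C\<in>set \<phi>. \<forall>l\<in>C. lit_var l \<in> {1..n})}"

definition num_satisfied :: "(nat \<Rightarrow> bool) \<Rightarrow> clause list \<Rightarrow> nat" where
  "num_satisfied a \<phi> = length (filter (clause_holds a) \<phi>)"

definition OPT :: "clause list \<Rightarrow> nat" where
  "OPT \<phi> = Max (range (\<lambda>a. num_satisfied a \<phi>))"

text \<open>The memory content is a bit string. Local computation between two arrivals is unrestricted,
  and it may depend on the number of clauses read so far without storing it.\<close>

record stream_alg =
  start :: "bool list"
  step :: "nat \<Rightarrow> bool list \<Rightarrow> clause \<Rightarrow> bool list"
  answer :: "bool list \<Rightarrow> nat"

primrec run_from :: "stream_alg \<Rightarrow> nat \<Rightarrow> bool list \<Rightarrow> clause list \<Rightarrow> bool list" where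
  "run_from A k w [] = w"
| "run_from A k w (C # \<phi>) = run_from A (Suc k) (step A k w C) \<phi>"

definition memory :: "stream_alg \<Rightarrow> clause list \<Rightarrow> bool list" where
  "memory A \<phi> = run_from A 0 (start A) \<phi>"

text \<open>A randomized algorithm is a probability distribution on deterministic ones: the random string
  is drawn in advance and can be consulted at any time free of charge. Since steps are indexed by
  time, this includes algorithms that toss fresh coins at each arrival. Space is counted in the worst
  case over the inputs, the random string and the positions in the stream.\<close>

definition uses_space :: "nat \<Rightarrow> nat \<Rightarrow> stream_alg pmf \<Rightarrow> nat \<Rightarrow> bool" where
  "uses_space m n \<A> s \<longleftrightarrow>
    (\<forall>A\<in>set_pmf \<A>. \<forall>\<phi>\<in>instances m n. \<forall>k\<le>m. length (memory A (take k \<phi>)) \<le> s)"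

definition decides_OPT_1_or_2 :: "nat \<Rightarrow> nat \<Rightarrow> stream_alg pmf \<Rightarrow> real \<Rightarrow> bool" where
  "decides_OPT_1_or_2 m n \<A> p \<longleftrightarrow>
    (\<forall>\<phi>\<in>instances m n. OPT \<phi> \<in> {1, 2} \<longrightarrow>
      measure_pmf.prob \<A> {A. answer A (memory A \<phi>) = OPT \<phi>} \<ge> p)"

end

theory Submission imports Defs begin

text \<open>Reduction from the one-way communication problem INDEX. With t = floor (log 2 (m - 1)), every
  set S of the first t variables gets a clause that prescribes all n variables: S on the first t of
  them, and row S of a bit matrix X on the other n - t. Different rows contradict each other, so an
  assignment satisfies at most one of these clauses. A last clause, which prescribes S on the first
  t variables and makes variable j true, can be satisfied together with a row clause if and only if
  X contains the entry (S, j). Hence the memory before the last clause allows each of the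
  2^t * (n - t) = Omega(mn) entries of X to be recovered with probability 2/3.

  For INDEX on N bits, fix the random string and let k(X, w) be the number of positions at which the
  guesses made from the message w agree with X. For fixed w, the sum of 2^k(X, w) over all X is 3^N,
  so it is at most |W| * 3^N if w is the message sent on X and W is the set of messages. As k has
  expectation at least pN, convexity bounds the expectation of this sum from below by 2^N * 2^(pN).
  For p = 2/3 this forces |W| to be exponential in N since 2^(5/3) > 3.\<close>

section \<open>The one-way communication complexity of INDEX\<close>

text \<open>Each index lies in or outside \<open>X\<close> independently and contributes a factor 2
  in exactly one of the two cases, so the sum factorises into factors 2 + 1.\<close>

lemma sum_Pow_two_power_agree:
  fixes I :: "'i set"
  assumes "finite I"
  shows "(\<Sum>X\<in>Pow I. (2::real) ^ card {i\<in>I. P i \<longleftrightarrow> i \<in> X}) = 3 ^ card I"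
proof -
  \<comment> \<open>The factors of an index inside and outside \<open>X\<close>,
    respectively.\<close>
  define f g :: "'i \<Rightarrow> real" where "f = (\<lambda>i. if P i then 2 else 1)" and "g = (\<lambda>i. if P i then 1 else 2)"
  have "(\<Sum>X\<in>Pow I. (2::real) ^ card {i\<in>I. P i \<longleftrightarrow> i \<in> X})
      = (\<Sum>X\<in>Pow I. prod f X * prod g (I - X))"
  proof (rule sum.cong)
    fix X assume "X \<in> Pow I"
    then have X: "X \<subseteq> I" "finite X" using assms finite_subset by auto
    have "(2::real) ^ card {i\<in>I. P i \<longleftrightarrow> i \<in> X} = (\<Prod>i\<in>I. if P i \<longleftrightarrow> i \<in> X then 2 else 1)"
      using assms by (simp add: prod.If_cases Int_def)
    also have "\<dots> = (\<Prod>i\<in>I - X. if P i \<longleftrightarrow> i \<in> X then 2 else 1) * (\<Prod>i\<in>X. if P i \<longleftrightarrow> i \<in> X then 2 else 1)"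
      using prod.subset_diff[OF X(1) assms] .
    also have "\<dots> = prod g (I - X) * prod f X"
      unfolding f_def g_def by (intro arg_cong2[where f = "(*)"] prod.cong) auto
    finally show "(2::real) ^ card {i\<in>I. P i \<longleftrightarrow> i \<in> X} = prod f X * prod g (I - X)"
      by simp
  qed simp
  also have "\<dots> = (\<Prod>i\<in>I. f i + g i)"
    using assms by (simp add: prod_add)
  also have "\<dots> = (\<Prod>i\<in>I. 3)"
    unfolding f_def g_def by (intro prod.cong) auto
  finally show ?thesis by simp
qed

text \<open>Shared randomness is allowed, since \<open>msg\<close> and \<open>out\<close> see the
  same \<open>A\<close>. The base exceeds 1 exactly when p > log 2 3 - 1, which is about
  0.585.\<close>

lemma index_lower_bound:
  fixes \<A> :: "'a pmf" and msg :: "'a \<Rightarrow> 'i set \<Rightarrow> 'w" and out :: "'a \<Rightarrow> 'w \<Rightarrow> 'i \<Rightarrow> bool"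
  assumes I: "finite I" and W: "finite W"
    and msg: "\<And>A X. A \<in> set_pmf \<A> \<Longrightarrow> X \<subseteq> I \<Longrightarrow> msg A X \<in> W"
    and succ: "\<And>X i. X \<subseteq> I \<Longrightarrow> i \<in> I \<Longrightarrow>
      measure_pmf.prob \<A> {A. out A (msg A X) i \<longleftrightarrow> i \<in> X} \<ge> p"
  shows "(2 powr (1 + p) / 3) ^ card I \<le> real (card W)"
proof -
  define N where "N = card I"
  define agree where "agree A w X = card {i\<in>I. out A w i \<longleftrightarrow> i \<in> X}" for A w X
  define F where "F A = (\<Sum>X\<in>Pow I. real (agree A (msg A X) X))" for A
  define a where "a = p * real N"
  have F: "2 powr a * (2 ^ N + ln 2 * (F A - 2 ^ N * a)) \<le> card W * 3 ^ N"
    if A: "A \<in> set_pmf \<A>" for A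
  proof -
    \<comment> \<open>The tangent of 2^x at \<open>a\<close> lies below the curve. Being affine in
      \<open>k\<close>, it does the work of Jensen's inequality.\<close>
    have tangent: "2 powr a * (1 + ln 2 * (real k - a)) \<le> 2 ^ k" for k :: nat
    proof -
      have "1 + ln 2 * (real k - a) \<le> 2 powr (real k - a)"
        using exp_ge_add_one_self[of "ln 2 * (real k - a)"] by (simp add: powr_def mult.commute)
      then have "2 powr a * (1 + ln 2 * (real k - a)) \<le> 2 powr a * 2 powr (real k - a)"
        by simp
      also have "\<dots> = 2 ^ k" by (simp add: powr_add[symmetric] powr_realpow)
      finally show ?thesis .
    qed
    have "2 powr a * (2 ^ N + ln 2 * (F A - 2 ^ N * a))
        = (\<Sum>X\<in>Pow I. 2 powr a * (1 + ln 2 * (real (agree A (msg A X) X) - a)))"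
      using I by (simp add: F_def N_def sum.distrib sum_subtractf card_Pow flip: sum_distrib_left)
    also have "\<dots> \<le> (\<Sum>X\<in>Pow I. 2 ^ agree A (msg A X) X)"
      by (intro sum_mono tangent)
    \<comment> \<open>Summing over all messages removes the dependence of the message on
      \<open>X\<close>, so that the sum over \<open>X\<close> can be evaluated for each fixed
      \<open>w\<close>.\<close>
    also have "\<dots> \<le> (\<Sum>X\<in>Pow I. \<Sum>w\<in>W. 2 ^ agree A w X)"
      using W msg[OF A] by (intro sum_mono member_le_sum) auto
    also have "\<dots> = (\<Sum>w\<in>W. \<Sum>X\<in>Pow I. 2 ^ agree A w X)"
      by (rule sum.swap)
    also have "\<dots> = card W * 3 ^ N"
      unfolding agree_def by (simp add: sum_Pow_two_power_agree[OF I] N_def)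
    finally show ?thesis .
  qed
  \<comment> \<open>The inequality \<open>F\<close> solved for \<open>F A\<close>. This bound is the
    same for every \<open>A\<close>, so it also bounds the expectation.\<close>
  define B where "B = 2 ^ N * a + (card W * 3 ^ N / 2 powr a - 2 ^ N) / ln 2"
  have "F A \<le> B" if "A \<in> set_pmf \<A>" for A
  proof -
    have "2 ^ N + ln 2 * (F A - 2 ^ N * a) \<le> card W * 3 ^ N / 2 powr a"
      using F[OF that] by (simp add: field_simps)
    then show ?thesis by (simp add: B_def field_simps)
  qed
  \<comment> \<open>Written with indicators, \<open>F\<close> has as expectation a sum of success
    probabilities.\<close>
  moreover have F_eq: "F A = (\<Sum>X\<in>Pow I. \<Sum>i\<in>I. indicator {A. out A (msg A X) i \<longleftrightarrow> i \<in> X} A)" for A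
    using I by (simp add: F_def agree_def indicator_def sum.If_cases Int_def)
  moreover have int: "integrable \<A> (indicator S :: 'a \<Rightarrow> real)" for S
    by (intro integrable_real_indicator) (simp_all add: less_top[symmetric])
  moreover have "integrable \<A> F"
    unfolding F_eq by (intro Bochner_Integration.integrable_sum int)
  ultimately have "measure_pmf.expectation \<A> F \<le> B"
    by (intro measure_pmf.integral_le_const) (auto simp: AE_measure_pmf_iff)
  moreover have "measure_pmf.expectation \<A> F
      = (\<Sum>X\<in>Pow I. \<Sum>i\<in>I. measure_pmf.prob \<A> {A. out A (msg A X) i \<longleftrightarrow> i \<in> X})"
    unfolding F_eq by (simp add: Bochner_Integration.integral_sum Bochner_Integration.integrable_sum int)
  moreover have "\<dots> \<ge> (\<Sum>X\<in>Pow I. \<Sum>i\<in>I. p)"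
    using succ by (intro sum_mono) auto
  ultimately have "2 ^ N * a \<le> B"
    using I by (simp add: a_def N_def card_Pow mult.commute)
  \<comment> \<open>The term \<open>2 ^ N * a\<close> cancels, so the quotient in \<open>B\<close>
    is nonnegative.\<close>
  then have "2 ^ N * 2 powr a \<le> card W * 3 ^ N"
    by (simp add: B_def field_simps)
  moreover have "2 ^ N * 2 powr a = (2 powr (1 + p)) ^ N"
    by (simp add: a_def powr_power powr_add power_mult_distrib mult.commute)
  ultimately show ?thesis
    by (simp add: N_def power_divide field_simps)
qed

section \<open>Streams and instances\<close>

lemma run_from_append:
  "run_from A k w (\<phi> @ \<psi>) = run_from A (k + length \<phi>) (run_from A k w \<phi>) \<psi>"
  by (induction \<phi> arbitrary: k w) auto

lemma memory_snoc: "memory A (\<phi> @ [C]) = step A (length \<phi>) (memory A \<phi>) C"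
  by (simp add: memory_def run_from_append)

lemma OPT_eqI:
  assumes "\<And>a. num_satisfied a \<phi> \<le> k" and "num_satisfied b \<phi> = k"
  shows "OPT \<phi> = k"
  unfolding OPT_def
proof (rule Max_eqI)
  show "finite (range (\<lambda>a. num_satisfied a \<phi>))"
    by (rule finite_subset[of _ "{..k}"]) (use assms(1) in auto)
qed (use assms in auto)

lemma num_satisfied_append [simp]:
  "num_satisfied a (\<phi> @ \<psi>) = num_satisfied a \<phi> + num_satisfied a \<psi>"
  by (simp add: num_satisfied_def)

lemma num_satisfied_single [simp]:
  "num_satisfied a [C] = (if clause_holds a C then 1 else 0)"
  by (simp add: num_satisfied_def)

text \<open>Contradictory clauses pad the stream to exactly m clauses without changing OPT.\<close>

lemma num_satisfied_replicate_contradiction [simp]: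
  "num_satisfied a (replicate k {Pos i, Neg i}) = 0"
  by (simp add: num_satisfied_def clause_holds_def)

section \<open>Clauses encoding a bit matrix and a query to it\<close>

definition cube :: "nat set \<Rightarrow> nat set \<Rightarrow> clause" where
  "cube V B = (\<lambda>i. if i \<in> B then Pos i else Neg i) ` V"

lemma clause_holds_cube: "clause_holds a (cube V B) \<longleftrightarrow> (\<forall>i\<in>V. a i \<longleftrightarrow> i \<in> B)"
proof -
  have "lit_holds a (if i \<in> B then Pos i else Neg i) \<longleftrightarrow> (a i \<longleftrightarrow> i \<in> B)" for i
    by simp
  then show ?thesis
    unfolding clause_holds_def cube_def by blast
qed

lemma lit_var_cube: "l \<in> cube V B \<Longrightarrow> lit_var l \<in> V"
  by (auto simp: cube_def)

text \<open>The matrix is the set \<open>X\<close> of its one-entries; rows are indexed by subsets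
  of the first \<open>t\<close> variables, columns by the remaining variables.\<close>

definition row_clause :: "nat \<Rightarrow> nat \<Rightarrow> (nat set \<times> nat) set \<Rightarrow> nat set \<Rightarrow> clause" where
  "row_clause n t X S = cube {1..n} (S \<union> {j\<in>{t<..n}. (S, j) \<in> X})"

definition query_clause :: "nat \<Rightarrow> nat set \<times> nat \<Rightarrow> clause" where
  "query_clause t = (\<lambda>(S, j). cube (insert j {1..t}) (insert j S))"

lemma clause_holds_row_clause:
  assumes "t \<le> n" "S \<subseteq> {1..t}"
  shows "clause_holds a (row_clause n t X S) \<longleftrightarrow>
    S = {i\<in>{1..t}. a i} \<and> (\<forall>j\<in>{t<..n}. a j \<longleftrightarrow> (S, j) \<in> X)"
proof -
  have split: "{1..n} = {1..t} \<union> {t<..n}" using assms(1) by auto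
  have "j \<notin> S" if "j \<in> {t<..n}" for j
    using that assms(2) by auto
  then have "clause_holds a (row_clause n t X S) \<longleftrightarrow>
      (\<forall>i\<in>{1..t}. a i \<longleftrightarrow> i \<in> S) \<and> (\<forall>j\<in>{t<..n}. a j \<longleftrightarrow> (S, j) \<in> X)"
    unfolding row_clause_def clause_holds_cube split ball_Un
    by (intro conj_cong ball_cong) simp_all
  also have "(\<forall>i\<in>{1..t}. a i \<longleftrightarrow> i \<in> S) \<longleftrightarrow> S = {i\<in>{1..t}. a i}"
    using assms(2) by blast
  finally show ?thesis .
qed

lemma clause_holds_query_clause:
  assumes "S \<subseteq> {1..t}" "t < j"
  shows "clause_holds a (query_clause t (S, j)) \<longleftrightarrow> S = {i\<in>{1..t}. a i} \<and> a j"
proof -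
  have "(\<forall>i\<in>{1..t}. a i \<longleftrightarrow> i \<in> insert j S) \<longleftrightarrow> (\<forall>i\<in>{1..t}. a i \<longleftrightarrow> i \<in> S)"
    using assms(2) by (intro ball_cong) auto
  then have "clause_holds a (query_clause t (S, j)) \<longleftrightarrow> (\<forall>i\<in>{1..t}. a i \<longleftrightarrow> i \<in> S) \<and> a j"
    unfolding query_clause_def clause_holds_cube prod.case by blast
  also have "(\<forall>i\<in>{1..t}. a i \<longleftrightarrow> i \<in> S) \<longleftrightarrow> S = {i\<in>{1..t}. a i}"
    using assms(1) by blast
  finally show ?thesis .
qed

text \<open>An assignment leaves a single candidate row: its own restriction to the first
  \<open>t\<close> variables.\<close>

lemma num_satisfied_row_clauses:
  assumes "t \<le> n" "distinct Ss" "set Ss = Pow {1..t}"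
  shows "num_satisfied a (map (row_clause n t X) Ss) =
    (if clause_holds a (row_clause n t X {i\<in>{1..t}. a i}) then 1 else 0)"
proof -
  let ?S = "{i\<in>{1..t}. a i}"
  have "num_satisfied a (map (row_clause n t X) Ss)
      = card {S \<in> Pow {1..t}. clause_holds a (row_clause n t X S)}"
    using assms by (simp add: num_satisfied_def filter_map distinct_length_filter comp_def Int_def conj_commute)
  also have "{S \<in> Pow {1..t}. clause_holds a (row_clause n t X S)} =
      (if clause_holds a (row_clause n t X ?S) then {?S} else {})"
  proof -
    have "S \<in> Pow {1..t} \<and> clause_holds a (row_clause n t X S) \<longleftrightarrow>
        S = ?S \<and> clause_holds a (row_clause n t X ?S)" for S
      using assms(1) clause_holds_row_clause[of t n S a X] by blast
    then show ?thesis by (simp del: Pow_iff)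
  qed
  finally show ?thesis by simp
qed

lemma OPT_index_instance:
  assumes "t \<le> n" "distinct Ss" "set Ss = Pow {1..t}" "S \<subseteq> {1..t}" "j \<in> {t<..n}"
  shows "OPT (map (row_clause n t X) Ss @ replicate k {Pos 1, Neg 1} @ [query_clause t (S, j)])
    = (if (S, j) \<in> X then 2 else 1)" (is "OPT ?\<phi> = _")
proof -
  define T where "T a = {i\<in>{1..t}. a i}" for a
  define R where "R a \<longleftrightarrow> (\<forall>j\<in>{t<..n}. a j \<longleftrightarrow> (T a, j) \<in> X)" for a
  define Q where "Q a \<longleftrightarrow> S = T a \<and> a j" for a
  have "T a \<subseteq> {1..t}" for a by (auto simp: T_def)
  then have "clause_holds a (row_clause n t X (T a)) \<longleftrightarrow> R a" for a
    by (simp only: clause_holds_row_clause[OF assms(1)] R_def T_def[symmetric] simp_thms)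
  moreover have "clause_holds a (query_clause t (S, j)) \<longleftrightarrow> Q a" for a
    using assms(4,5) by (simp add: clause_holds_query_clause Q_def T_def)
  ultimately have num: "num_satisfied a ?\<phi> = of_bool (R a) + of_bool (Q a)" for a
    using num_satisfied_row_clauses[OF assms(1-3), of a X, folded T_def] by simp
  show ?thesis
  proof (cases "(S, j) \<in> X")
    case True
    define b where "b i \<longleftrightarrow> i \<in> S \<or> t < i \<and> (S, i) \<in> X" for i
    have "T b = S" using assms(4) by (auto simp: T_def b_def)
    moreover have "i \<notin> S" if "i \<in> {t<..n}" for i
      using that assms(4) by auto
    ultimately have "R b" "Q b"
      using True assms(5) by (simp_all add: R_def Q_def b_def)
    then have "num_satisfied b ?\<phi> = 2" by (simp only: num) simp
    moreover have "num_satisfied a ?\<phi> \<le> 2" for a by (simp only: num) simp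
    ultimately have "OPT ?\<phi> = 2" by (intro OPT_eqI)
    then show ?thesis using True by simp
  next
    case False
    have not_both: "\<not> (R a \<and> Q a)" for a
      using False assms(5) unfolding R_def Q_def by blast
    \<comment> \<open>This witness satisfies the query clause, which excludes OPT = 0.\<close>
    define b where "b i \<longleftrightarrow> i \<in> insert j S" for i
    have "T b = S" using assms(4,5) by (auto simp: T_def b_def)
    then have "Q b" by (simp add: Q_def b_def)
    then have "num_satisfied b ?\<phi> = 1" using not_both[of b] by (simp only: num) simp
    moreover have "num_satisfied a ?\<phi> \<le> 1" for a
      using not_both[of a] by (simp only: num) (simp add: of_bool_def)
    ultimately have "OPT ?\<phi> = 1" by (intro OPT_eqI)
    then show ?thesis using False by simp
  qed
qed

lemma index_instance_in_instances:
  assumes "t \<le> n" "1 \<le> n" "S \<subseteq> {1..t}" "j \<in> {t<..n}" "length Ss + k + 1 = m"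
  shows "map (row_clause n t X) Ss @ replicate k {Pos 1, Neg 1} @ [query_clause t (S, j)]
    \<in> instances m n"
proof -
  have "lit_var l \<in> {1..n}" if "l \<in> row_clause n t X T" for l T
    using lit_var_cube that unfolding row_clause_def by blast
  moreover have "lit_var l \<in> {1..n}" if "l \<in> query_clause t (S, j)" for l
  proof -
    have "lit_var l \<in> insert j {1..t}"
      using lit_var_cube that unfolding query_clause_def by blast
    then show ?thesis using assms by auto
  qed
  ultimately show ?thesis
    using assms by (auto simp: instances_def)
qed

section \<open>The reduction\<close>

text \<open>The memory after m - 1 clauses is the message, and the receiver feeds in the query
  clause. The right-hand side counts the bit strings of length at most \<open>s\<close>.\<close>

lemma stream_messages_lower_bound:
  assumes "decides_OPT_1_or_2 m n \<A> p" and "uses_space m n \<A> s"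
    and t: "t < n" "2 ^ t < m"
  shows "(2 powr (1 + p) / 3) ^ (2 ^ t * (n - t)) \<le> 2 ^ (s + 1) - 1"
proof -
  obtain Ss where Ss: "set Ss = Pow {1..t}" "distinct Ss"
    using finite_distinct_list[of "Pow {1..t}"] by auto
  have len: "length Ss = 2 ^ t"
    using distinct_card[OF Ss(2)] Ss(1) by (simp add: card_Pow)
  define I where "I = Pow {1..t} \<times> {t<..n}"
  define W where "W = {w :: bool list. length w \<le> s}"
  define pre where
    "pre X = map (row_clause n t X) Ss @ replicate (m - 1 - 2 ^ t) {Pos 1, Neg 1}" for X
  have len_pre: "length (pre X) = m - 1" for X
    using t by (simp add: pre_def len)
  have inst: "pre X @ [query_clause t q] \<in> instances m n"
    and opt: "OPT (pre X @ [query_clause t q]) = (if q \<in> X then 2 else 1)" if "q \<in> I" for X q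
  proof -
    obtain S j where q: "q = (S, j)" "S \<subseteq> {1..t}" "j \<in> {t<..n}"
      using \<open>q \<in> I\<close> unfolding I_def by (rule SigmaE) simp
    show "pre X @ [query_clause t q] \<in> instances m n"
      using index_instance_in_instances[of t n S j Ss "m - 1 - 2 ^ t" m X] t len q
      by (simp add: pre_def)
    show "OPT (pre X @ [query_clause t q]) = (if q \<in> X then 2 else 1)"
      using OPT_index_instance[of t n Ss S j X "m - 1 - 2 ^ t"] t Ss q
      by (simp add: pre_def)
  qed
  have fin: "finite I" by (simp add: I_def)
  \<comment> \<open>The space bound speaks only of prefixes of full instances, so some query is
    needed to complete \<open>pre X\<close> to one.\<close>
  have ne: "({}, n) \<in> I" using t by (simp add: I_def)
  have W_eq: "W = {w. set w \<subseteq> UNIV \<and> length w \<le> s}" by (simp add: W_def)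
  have finW: "finite W"
    unfolding W_eq by (rule finite_lists_length_le) simp
  have "(2 powr (1 + p) / 3) ^ card I \<le> real (card W)"
  proof (rule index_lower_bound[where msg = "\<lambda>A X. memory A (pre X)" and \<A> = \<A>
        and out = "\<lambda>A w q. answer A (step A (m - 1) w (query_clause t q)) = 2"])
    show "memory A (pre X) \<in> W" if "A \<in> set_pmf \<A>" for A X
    proof -
      have "length (memory A (take (m - 1) (pre X @ [query_clause t ({}, n)]))) \<le> s"
        using assms(2) that inst[OF ne, of X] diff_le_self[of m 1]
        unfolding uses_space_def by blast
      then show ?thesis by (simp add: W_def len_pre)
    qed
    show "p \<le> measure_pmf.prob \<A>
        {A. (answer A (step A (m - 1) (memory A (pre X)) (query_clause t q)) = 2) = (q \<in> X)}"
      if "q \<in> I" for X q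
    proof -
      let ?\<phi> = "pre X @ [query_clause t q]"
      have "p \<le> measure_pmf.prob \<A> {A. answer A (memory A ?\<phi>) = OPT ?\<phi>}"
        using assms(1) inst[OF that] opt[OF that] unfolding decides_OPT_1_or_2_def by simp
      \<comment> \<open>Every answer other than 2 is read as the guess that the entry is 0.\<close>
      also have "\<dots> \<le> measure_pmf.prob \<A>
          {A. (answer A (step A (m - 1) (memory A (pre X)) (query_clause t q)) = 2) = (q \<in> X)}"
        by (rule measure_pmf.finite_measure_mono) (auto simp: opt[OF that] memory_snoc len_pre)
      finally show ?thesis .
    qed
  qed (fact fin finW)+
  moreover have "card I = 2 ^ t * (n - t)"
    by (simp add: I_def card_cartesian_product card_Pow)
  moreover have "real (card W) = 2 ^ (s + 1) - 1"
  proof -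
    have "card W = (\<Sum>i\<le>s. 2 ^ i)"
      unfolding W_eq by (subst card_lists_length_le) auto
    then have "real (card W) = (\<Sum>i<Suc s. 2 ^ i)"
      by (simp add: lessThan_Suc_atMost)
    then show ?thesis by (simp add: geometric_sum)
  qed
  ultimately show ?thesis by simp
qed

theorem theorem5:
  fixes K :: real
  assumes "K > 1"
  shows "\<exists>c>0. \<forall>(m::nat) (n::nat) (s::nat) \<A>.
    m \<ge> 2 \<longrightarrow> real n \<ge> K * log 2 (real m) \<longrightarrow>
    decides_OPT_1_or_2 m n \<A> (2/3) \<longrightarrow> uses_space m n \<A> s \<longrightarrow>
    real s \<ge> c * real m * real n"
proof -
  define q :: real where "q = 2 powr (1 + 2/3) / 3"
  \<comment> \<open>Cubing reduces the claim to 27 < 32.\<close>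
  have "(3::real) powr 3 < (2 powr (5/3)) powr 3"
    by (simp only: powr_powr) simp
  then have "(3::real) < 2 powr (5/3)"
    by (meson not_le powr_ge_zero powr_mono2 zero_le_numeral)
  then have q: "q > 1" by (simp add: q_def)
  \<comment> \<open>One factor 1/2 comes from 2^t >= m/2, the other from s + 1 <= 2s. At least the
    fraction 1 - 1/K of the variables remains for the columns.\<close>
  define c where "c = log 2 q / 4 * (1 - 1 / K)"
  have "c > 0" using q assms by (simp add: c_def)
  moreover have "real s \<ge> c * real m * real n"
    if m: "m \<ge> 2" and n: "real n \<ge> K * log 2 (real m)"
      and alg: "decides_OPT_1_or_2 m n \<A> (2/3)" "uses_space m n \<A> s" for m n s \<A>
  proof -
    \<comment> \<open>The bound m - 1 instead of m leaves room for the query clause.\<close>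
    obtain t where t: "2 ^ t \<le> m - 1" "m - 1 < 2 ^ (t + 1)"
      using ex_power_ivl1[of 2 "m - 1"] m by fastforce
    then have tm: "2 ^ t < m" "m \<le> 2 * 2 ^ t" using m by auto
    have "real t \<le> log 2 (real m)"
      using tm(1) m by (simp add: le_log_iff powr_realpow flip: of_nat_power)
    then have "K * real t \<le> real n"
      using n assms by (smt (verit) mult_left_mono)
    then have tK: "real t \<le> real n / K"
      using assms by (simp add: field_simps)
    have "0 < K * log 2 (real m)" using assms m by simp
    then have "n > 0" using n by linarith
    then have "real n / K < real n" using assms by (simp add: field_simps)
    then have tn: "t < n" using tK by linarith
    define N where "N = 2 ^ t * (n - t)"
    have N: "N > 0" using tn by (simp add: N_def)
    have bound: "q ^ N \<le> 2 ^ (s + 1) - 1"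
      unfolding q_def N_def using stream_messages_lower_bound[OF alg tn tm(1)] .
    moreover have "q ^ N > 1" using q N by (simp add: one_less_power)
    \<comment> \<open>For s = 0 the bound would read q^N <= 1.\<close>
    ultimately have "s \<ge> 1" by (cases s) auto
    have "real N * log 2 q = log 2 (q ^ N)" using q by (simp add: log_nat_power)
    also have "\<dots> \<le> log 2 (2 ^ (s + 1))"
      using bound \<open>q ^ N > 1\<close> by (intro log_mono) auto
    also have "\<dots> = real (s + 1)" by (simp only: log_pow_cancel)
    also have "\<dots> \<le> 2 * real s" using \<open>s \<ge> 1\<close> by simp
    finally have s: "real N * log 2 q / 2 \<le> real s" by simp
    have "(real m / 2) * (real n * (1 - 1 / K)) \<le> 2 ^ t * (real n - real t)"
    proof (intro mult_mono)
      show "real m / 2 \<le> 2 ^ t" using tm(2) by (simp flip: of_nat_le_iff[where 'a = real])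
      show "real n * (1 - 1 / K) \<le> real n - real t" using tK by (simp add: algebra_simps)
    qed (use assms in auto)
    also have "\<dots> = real N" using tn by (simp add: N_def of_nat_diff)
    finally have "(real m / 2) * (real n * (1 - 1 / K)) * (log 2 q / 2) \<le> real N * (log 2 q / 2)"
      using q by (intro mult_right_mono) auto
    with s show ?thesis by (simp add: c_def algebra_simps)
  qed
  ultimately show ?thesis by blast
qed

end
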